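(* Let $\Gamma$ be a canonical signed unicyclic graph whose unique cycle $C_g^\sigma$ has length $g$. (1) If $\Gamma=C_g^\sigma$ is a cycle, then $i_+(\Gamma)=\lceil g/2\rceil$ if and only if either $C_g^\sigma$ is balanced and $g\equiv 1,2\pmod 4$, or $C_g^\sigma$ is unbalanced and $g\equiv 0,3\pmod 4$. Suppose now $\Gamma$ is not a cycle. Let $v_1,\dots,v_k$ ($k\ge1$) be the major vertices in cyclic order along $C_g^\sigma$, and let $l_1,\dots,l_k\ge0$ be the numbers of cycle vertices strictly between consecutive major vertices (indices mod $k$; for $k=1$, $l_1=g-1$), so that $g=k+l_1+\cdots+l_k$. (2) If $g\equiv 1,3\pmod 4$, then $i_+(\Gamma)=\lceil g/2\rceil$ if and only if exactly one of $l_1,\dots,l_k$ is even. (3) If $g\equiv 0,2\pmod 4$, then $i_+(\Gamma)=\lceil g/2\rceil$ if and only if all of $l_1,\dots,l_k$ are odd.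
   Context: A signed graph $\Gamma=(G,\sigma)$ is a simple graph $G$ with a sign function $\sigma:E(G)\to\{+,-\}$; its adjacency matrix has $(u,v)$-entry $\sigma(uv)$ if $uv\in E(G)$, $0$ otherwise, and $i_+(\Gamma)$ is its number of positive eigenvalues. A cycle is balanced if the product of its edge signs is $+$, unbalanced otherwise. A signed unicyclic graph is a connected signed graph with exactly one cycle. It is called canonical if, with $C$ its unique cycle, every vertex not on $C$ is adjacent to exactly one vertex of $C$ and the vertices not on $C$ are pairwise nonadjacent. A vertex of $C$ having at least one neighbour outside $C$ is called a major vertex. *)

theory Defs
  imports "Jordan_Normal_Form.Char_Poly"
begin

definition signed_graph :: "nat \<Rightarrow> (nat \<Rightarrow> nat \<Rightarrow> bool) \<Rightarrow> (nat \<Rightarrow> nat \<Rightarrow> real) \<Rightarrow> bool" where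
  "signed_graph n E sg \<longleftrightarrow>
     (\<forall>i j. E i j \<longrightarrow> i < n \<and> j < n \<and> i \<noteq> j \<and> E j i) \<and>
     (\<forall>i j. E i j \<longrightarrow> sg i j = sg j i \<and> (sg i j = 1 \<or> sg i j = -1))"

definition adj_matrix :: "nat \<Rightarrow> (nat \<Rightarrow> nat \<Rightarrow> bool) \<Rightarrow> (nat \<Rightarrow> nat \<Rightarrow> real) \<Rightarrow> real mat" where
  "adj_matrix n E sg = mat n n (\<lambda>(i, j). if E i j then sg i j else 0)"

definition pos_inertia :: "real mat \<Rightarrow> nat" where
  "pos_inertia A = (\<Sum>a\<in>{a. a > 0 \<and> poly (char_poly A) a = 0}. order a (char_poly A))"

definition connected_graph :: "nat \<Rightarrow> (nat \<Rightarrow> nat \<Rightarrow> bool) \<Rightarrow> bool" where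
  "connected_graph n E \<longleftrightarrow> (\<forall>i<n. \<forall>j<n. E\<^sup>*\<^sup>* i j)"

definition is_cycle :: "nat \<Rightarrow> (nat \<Rightarrow> nat \<Rightarrow> bool) \<Rightarrow> nat list \<Rightarrow> bool" where
  "is_cycle n E cs \<longleftrightarrow> length cs \<ge> 3 \<and> distinct cs \<and> set cs \<subseteq> {..<n} \<and>
     (\<forall>i<length cs. E (cs ! i) (cs ! ((i + 1) mod length cs)))"

definition cycle_edges :: "nat list \<Rightarrow> nat set set" where
  "cycle_edges cs = {{cs ! i, cs ! ((i + 1) mod length cs)} | i. i < length cs}"

definition unicyclic :: "nat \<Rightarrow> (nat \<Rightarrow> nat \<Rightarrow> bool) \<Rightarrow> bool" where
  "unicyclic n E \<longleftrightarrow> connected_graph n E \<and> (\<exists>cs. is_cycle n E cs) \<and>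
     (\<forall>cs cs'. is_cycle n E cs \<and> is_cycle n E cs' \<longrightarrow> cycle_edges cs = cycle_edges cs')"

definition canonical_unicyclic :: "nat \<Rightarrow> (nat \<Rightarrow> nat \<Rightarrow> bool) \<Rightarrow> bool" where
  "canonical_unicyclic n E \<longleftrightarrow> unicyclic n E \<and>
     (\<forall>cs. is_cycle n E cs \<longrightarrow>
        (\<forall>v<n. v \<notin> set cs \<longrightarrow> card {u \<in> set cs. E v u} = 1) \<and>
        (\<forall>u<n. \<forall>v<n. u \<notin> set cs \<and> v \<notin> set cs \<longrightarrow> \<not> E u v))"

definition balanced_cycle :: "(nat \<Rightarrow> nat \<Rightarrow> real) \<Rightarrow> nat list \<Rightarrow> bool" where
  "balanced_cycle sg cs \<longleftrightarrow>
     (\<Prod>i<length cs. sg (cs ! i) (cs ! ((i + 1) mod length cs))) = 1"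

definition major_vertex :: "nat \<Rightarrow> (nat \<Rightarrow> nat \<Rightarrow> bool) \<Rightarrow> nat list \<Rightarrow> nat \<Rightarrow> bool" where
  "major_vertex n E cs v \<longleftrightarrow> v \<in> set cs \<and> (\<exists>u<n. u \<notin> set cs \<and> E v u)"

text \<open>For the major vertex at position p of the cycle list, the number of cycle vertices
strictly between it and the next major vertex in cyclic order (g-1 if it is the only one).\<close>
definition major_gap :: "nat \<Rightarrow> (nat \<Rightarrow> nat \<Rightarrow> bool) \<Rightarrow> nat list \<Rightarrow> nat \<Rightarrow> nat" where
  "major_gap n E cs p =
     (LEAST d. 0 < d \<and> major_vertex n E cs (cs ! ((p + d) mod length cs))) - 1"

end

theory Submission
  imports Defs
begin

text \<open>
  Diagonalise the adjacency matrix orthogonally. If the quadratic form is nonpositive on the common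
  kernel of \<open>k\<close> linear functionals, then there are at most \<open>k\<close> positive eigenvalues; in particular
  a vertex cover bounds both the number of positive and the number of negative eigenvalues, because
  the form vanishes on vectors supported off the cover. Conversely, if no nonzero kernel vector is
  supported on \<open>W\<close>, then at least \<open>card W\<close> eigenvalues are nonzero.

  If there are major vertices, let \<open>S\<close> be the set of cycle vertices at even distance from the next
  major vertex. It is a vertex cover, it can be matched with \<open>card S\<close> further vertices (a major
  vertex with a pendant one, any other with its successor), and the kernel is trivial on the matched
  vertices. Hence \<open>i\<^sub>+ = card S\<close>. Shifting by one position shows \<open>2 card S = g + e\<close>, where \<open>e\<close> is the
  number of even gaps, so that \<open>i\<^sub>+ = \<lceil>g/2\<rceil>\<close> iff \<open>e\<close> is the parity of \<open>g\<close>.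

  For a bare cycle with product of signs \<open>\<tau>\<close>, put \<open>\<epsilon> = (-1)\<^bsup>\<lfloor>g/2\<rfloor>\<^esup> \<tau>\<close>. Forcing the values
  on the even positions to be \<open>x\<^bsub>2i\<^esub> = \<plusminus>x\<^sub>0\<close>, so that all the odd rows vanish, the form becomes
  \<open>2\<epsilon>x\<^sub>0\<^sup>2\<close> when \<open>g\<close> is odd, and \<open>0\<close> when \<open>g\<close> is even and \<open>\<epsilon> = 1\<close>. In the remaining case the
  matrix is nonsingular, as it is whenever \<open>g\<close> is odd.
\<close>

section \<open>Diagonalisation of real symmetric matrices\<close>

lemma scalar_prod_self_nonneg: "v \<bullet> v \<ge> 0" for v :: "real vec"
  by (simp add: scalar_prod_def sum_nonneg)

lemma scalar_prod_self_pos: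
  fixes v :: "real vec"
  assumes "v \<in> carrier_vec n" "v \<noteq> 0\<^sub>v n"
  shows "v \<bullet> v > 0"
proof -
  obtain i where "i < n" "v $ i \<noteq> 0" using assms by (auto simp: vec_eq_iff)
  then show ?thesis
    unfolding scalar_prod_def using assms(1) by (intro sum_pos2[of _ i]) (auto simp: zero_less_mult_iff)
qed

text \<open>A complex eigenvector \<open>z\<close> exists because the characteristic polynomial
  splits over the complex numbers. Symmetry, applied to its real and imaginary parts
  \<open>x\<close> and \<open>y\<close>, gives
  \<open>Im l * (x \<bullet> x + y \<bullet> y) = 0\<close>; hence \<open>l\<close> is real and
  whichever of \<open>x\<close>, \<open>y\<close> is nonzero serves.\<close>

lemma real_symmetric_eigenvector:
  fixes A :: "real mat"
  assumes A: "A \<in> carrier_mat n n" and sym: "A\<^sup>T = A" and n: "0 < n"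
  obtains e v where "eigenvector A v e"
proof -
  let ?C = "map_mat complex_of_real A"
  have C: "?C \<in> carrier_mat n n" using A by simp
  obtain as where as: "char_poly ?C = (\<Prod>a\<leftarrow>as. [:- a, 1:])" "length as = n"
    using char_poly_factorized[OF C] by blast
  obtain l where "l \<in> set as" using as(2) n by (cases as) auto
  then have "poly (char_poly ?C) l = 0"
    by (auto simp: as(1) poly_prod_list prod_list_zero_iff)
  then obtain z where z: "eigenvector ?C z l"
    using eigenvalue_root_char_poly[OF C] unfolding eigenvalue_def by blast
  then have zc: "z \<in> carrier_vec n" and z0: "z \<noteq> 0\<^sub>v n" and ze: "?C *\<^sub>v z = l \<cdot>\<^sub>v z"
    using A unfolding eigenvector_def by auto
  define x where "x = map_vec Re z"
  define y where "y = map_vec Im z"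
  have xc: "x \<in> carrier_vec n" and yc: "y \<in> carrier_vec n"
    using zc by (auto simp: x_def y_def)
  have comp: "(?C *\<^sub>v z) $ i = l * z $ i" if "i < n" for i
    using ze that zc by simp
  have mv: "(?C *\<^sub>v z) $ i = (\<Sum>j = 0..<n. complex_of_real (A $$ (i, j)) * z $ j)" if "i < n" for i
    using that A zc by (auto simp: scalar_prod_def intro!: sum.cong)
  have Ax: "A *\<^sub>v x = Re l \<cdot>\<^sub>v x - Im l \<cdot>\<^sub>v y"
  proof (rule eq_vecI)
    fix i assume "i < dim_vec (Re l \<cdot>\<^sub>v x - Im l \<cdot>\<^sub>v y)"
    then have i: "i < n" using yc by simp
    have "(A *\<^sub>v x) $ i = Re ((?C *\<^sub>v z) $ i)"
      unfolding mv[OF i] using i A zc xc by (auto simp: scalar_prod_def x_def intro!: sum.cong)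
    then show "(A *\<^sub>v x) $ i = (Re l \<cdot>\<^sub>v x - Im l \<cdot>\<^sub>v y) $ i"
      unfolding comp[OF i] using i zc xc yc by (simp add: x_def y_def)
  qed (use A yc in auto)
  have Ay: "A *\<^sub>v y = Im l \<cdot>\<^sub>v x + Re l \<cdot>\<^sub>v y"
  proof (rule eq_vecI)
    fix i assume "i < dim_vec (Im l \<cdot>\<^sub>v x + Re l \<cdot>\<^sub>v y)"
    then have i: "i < n" using yc by simp
    have "(A *\<^sub>v y) $ i = Im ((?C *\<^sub>v z) $ i)"
      unfolding mv[OF i] using i A zc yc by (auto simp: scalar_prod_def y_def intro!: sum.cong)
    then show "(A *\<^sub>v y) $ i = (Im l \<cdot>\<^sub>v x + Re l \<cdot>\<^sub>v y) $ i"
      unfolding comp[OF i] using i zc xc yc by (simp add: x_def y_def)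
  qed (use A yc in auto)
  have "y \<bullet> (A *\<^sub>v x) = (A *\<^sub>v y) \<bullet> x"
    using transpose_vec_mult_scalar[OF A xc yc] sym by simp
  then have "Im l * (x \<bullet> x + y \<bullet> y) = 0"
    unfolding Ax Ay using xc yc
    by (simp add: scalar_prod_minus_distrib[of _ n] add_scalar_prod_distrib[of _ n]
        comm_scalar_prod[of x n y] algebra_simps)
  moreover have "x \<noteq> 0\<^sub>v n \<or> y \<noteq> 0\<^sub>v n"
  proof (rule ccontr)
    assume "\<not> ?thesis"
    then have 0: "x = 0\<^sub>v n" "y = 0\<^sub>v n" by auto
    have "z $ i = 0" if "i < n" for i
    proof -
      have "x $ i = 0" "y $ i = 0" using 0 that by auto
      then show ?thesis using that zc by (simp add: x_def y_def complex_eq_iff)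
    qed
    then show False using z0 zc by (auto intro: eq_vecI)
  qed
  moreover have "x \<bullet> x \<ge> 0" "y \<bullet> y \<ge> 0" "x \<noteq> 0\<^sub>v n \<longrightarrow> x \<bullet> x > 0" "y \<noteq> 0\<^sub>v n \<longrightarrow> y \<bullet> y > 0"
    using scalar_prod_self_nonneg scalar_prod_self_pos xc yc by auto
  ultimately have "Im l = 0"
    by (smt (verit) mult_eq_0_iff)
  then have "eigenvector A x (Re l) \<or> eigenvector A y (Re l)"
    using Ax Ay xc yc A \<open>x \<noteq> 0\<^sub>v n \<or> y \<noteq> 0\<^sub>v n\<close>
    by (auto simp: eigenvector_def)
  then show thesis using that by blast
qed

text \<open>The Householder reflection exchanging \<open>v\<close> and the first basis vector; \<open>c = 0\<close> covers the
  case that they coincide.\<close>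

lemma unit_vector_to_first_basis_vector:
  fixes v :: "real vec"
  assumes v: "v \<in> carrier_vec n" and unit: "v \<bullet> v = 1"
  obtains H where "H \<in> carrier_mat n n" "H\<^sup>T = H" "H * H = 1\<^sub>m n" "H *\<^sub>v v = unit_vec n 0"
proof -
  define w where "w i = v $ i - (if i = 0 then 1 else 0)" for i
  define N where "N = (\<Sum>k<n. w k * w k)"
  define c where "c = (if N = 0 then 0 else 2 / N)"
  define H where "H = mat n n (\<lambda>(i, j). (if i = j then 1 else 0) - c * w i * w j)"
  have n: "n > 0" using unit v by (cases n) (auto simp: scalar_prod_def)
  have H: "H \<in> carrier_mat n n" by (simp add: H_def)
  have sym: "H\<^sup>T = H" by (rule eq_matI) (auto simp: H_def)
  \<comment> \<open>Holds for both values of \<open>c\<close>; it makes the quadratic term cancel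
    the two linear ones in \<open>H * H\<close>.\<close>
  have cN: "c * c * N = 2 * c" by (simp add: c_def)
  have w0: "w i = 0" if "N = 0" "i < n" for i
  proof -
    have "\<forall>k\<in>{..<n}. w k * w k = 0"
      using that(1) unfolding N_def by (subst (asm) sum_nonneg_eq_0_iff) auto
    then show ?thesis using that(2) by simp
  qed
  have sumv: "(\<Sum>k<n. v $ k * v $ k) = 1"
    using unit v by (simp add: scalar_prod_def atLeast0LessThan)
  have vw: "(\<Sum>k<n. w k * v $ k) = 1 - v $ 0"
  proof -
    have "(\<Sum>k<n. w k * v $ k) = (\<Sum>k<n. v $ k * v $ k - (if k = 0 then v $ 0 else 0))"
      by (rule sum.cong) (auto simp: w_def algebra_simps)
    then show ?thesis using n by (simp add: sum_subtractf sumv)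
  qed
  have N: "N = 2 * (1 - v $ 0)"
  proof -
    have "N = (\<Sum>k<n. w k * v $ k - (if k = 0 then w k else 0))"
      unfolding N_def by (rule sum.cong) (auto simp: w_def algebra_simps)
    also have "\<dots> = (1 - v $ 0) - w 0" using n by (simp add: sum_subtractf vw)
    finally show ?thesis by (simp add: w_def)
  qed
  have "H * H = 1\<^sub>m n"
  proof (rule eq_matI)
    fix i j assume "i < dim_row (1\<^sub>m n :: real mat)" "j < dim_col (1\<^sub>m n :: real mat)"
    then have ij: "i < n" "j < n" by auto
    have "(H * H) $$ (i, j) = (\<Sum>k<n. ((if i = k then 1 else 0) - c * w i * w k) *
        ((if k = j then 1 else 0) - c * w k * w j))"
      using ij by (simp add: H_def scalar_prod_def atLeast0LessThan)
    also have "\<dots> = (\<Sum>k<n. (if k = i then (if i = j then 1 else 0) - c * w i * w j else 0)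
        - (if k = j then c * w i * w j else 0) + (c * c * w i * w j) * (w k * w k))"
      by (rule sum.cong) (auto simp: algebra_simps)
    also have "\<dots> = (if i = j then 1 else 0) - 2 * (c * w i * w j) + (c * c * N) * w i * w j"
      using ij by (simp add: sum.distrib sum_subtractf N_def flip: sum_distrib_left)
    also have "\<dots> = (1\<^sub>m n :: real mat) $$ (i, j)" using ij by (simp add: cN)
    finally show "(H * H) $$ (i, j) = (1\<^sub>m n :: real mat) $$ (i, j)" .
  qed (auto simp: H_def)
  moreover have "H *\<^sub>v v = unit_vec n 0"
  proof (rule eq_vecI)
    fix i assume "i < dim_vec (unit_vec n 0 :: real vec)"
    then have i: "i < n" by simp
    have "(H *\<^sub>v v) $ i = (\<Sum>k<n. ((if i = k then 1 else 0) - c * w i * w k) * v $ k)"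
      using i v by (simp add: H_def scalar_prod_def atLeast0LessThan)
    also have "\<dots> = (\<Sum>k<n. (if k = i then v $ i else 0) - (c * w i) * (w k * v $ k))"
      by (rule sum.cong) (auto simp: algebra_simps)
    also have "\<dots> = v $ i - c * w i * (1 - v $ 0)"
      using i by (simp add: sum_subtractf vw flip: sum_distrib_left)
    also have "\<dots> = v $ i - w i"
    proof (cases "N = 0")
      case True
      then show ?thesis using w0 i by simp
    next
      case False
      then have "c * (1 - v $ 0) = 1" using N by (simp add: c_def)
      then show ?thesis by (metis mult.assoc mult.commute mult.right_neutral)
    qed
    also have "\<dots> = unit_vec n 0 $ i" using i by (simp add: w_def unit_vec_def)
    finally show "(H *\<^sub>v v) $ i = unit_vec n 0 $ i" .
  qed (auto simp: H_def)
  ultimately show thesis using that H sym by blast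
qed

text \<open>Deflation by induction on the dimension: a reflection moves a unit eigenvector to the
  first axis and leaves a symmetric block of size \<open>m\<close>. Taking \<open>U\<^sup>T\<close>
  as second witness makes \<open>U\<close> orthogonal.\<close>

theorem real_symmetric_diagonalization:
  fixes A :: "real mat"
  assumes "A \<in> carrier_mat n n" and "A\<^sup>T = A"
  shows "\<exists>U d. similar_mat_wit A (mat_diag n d) U U\<^sup>T"
  using assms
proof (induction n arbitrary: A)
  case 0
  then have "A = mat_diag 0 (\<lambda>_. 0)" by (intro eq_matI) (auto simp: mat_diag_def)
  then have "similar_mat_wit A (mat_diag 0 (\<lambda>_. 0)) (1\<^sub>m 0) ((1\<^sub>m 0)\<^sup>T)"
    using similar_mat_wit_refl[OF "0.prems"(1)] by simp
  then show ?case by blast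
next
  case (Suc m)
  note A = Suc.prems(1)
  obtain e z where z: "eigenvector A z e"
    using real_symmetric_eigenvector[OF Suc.prems] by blast
  then have zc: "z \<in> carrier_vec (Suc m)" and z0: "z \<noteq> 0\<^sub>v (Suc m)" and ze: "A *\<^sub>v z = e \<cdot>\<^sub>v z"
    using A unfolding eigenvector_def by auto
  have zz: "z \<bullet> z > 0" using scalar_prod_self_pos[OF zc z0] .
  define v where "v = (1 / sqrt (z \<bullet> z)) \<cdot>\<^sub>v z"
  have v: "v \<in> carrier_vec (Suc m)" using zc by (simp add: v_def)
  have "v \<bullet> v = 1" using zz zc by (simp add: v_def)
  have ve: "A *\<^sub>v v = e \<cdot>\<^sub>v v"
    using zc A by (simp add: v_def mult_mat_vec ze smult_smult_assoc mult.commute)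
  obtain H where H: "H \<in> carrier_mat (Suc m) (Suc m)" "H\<^sup>T = H" "H * H = 1\<^sub>m (Suc m)"
    "H *\<^sub>v v = unit_vec (Suc m) 0"
    using unit_vector_to_first_basis_vector[OF v \<open>v \<bullet> v = 1\<close>] by blast
  have Hu: "H *\<^sub>v unit_vec (Suc m) 0 = v"
    using H v by (metis assoc_mult_mat_vec one_mult_mat_vec)
  define B where "B = H * A * H"
  have B: "B \<in> carrier_mat (Suc m) (Suc m)" using H A by (simp add: B_def)
  have symB: "B\<^sup>T = B"
    unfolding B_def using H(1,2) A Suc.prems(2)
    by (simp add: transpose_mult[of _ "Suc m" "Suc m" _ "Suc m"] assoc_mult_mat[of _ "Suc m" "Suc m" _ "Suc m" _ "Suc m"])
  have "B *\<^sub>v unit_vec (Suc m) 0 = e \<cdot>\<^sub>v unit_vec (Suc m) 0"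
    unfolding B_def using H A v
    by (simp add: assoc_mult_mat_vec[of _ "Suc m" "Suc m" _ "Suc m"] Hu ve mult_mat_vec)
  then have col0: "B $$ (i, 0) = (if i = 0 then e else 0)" if "i < Suc m" for i
  proof -
    have "(B *\<^sub>v unit_vec (Suc m) 0) $ i = B $$ (i, 0)"
      using that B by simp
    then show ?thesis using that \<open>B *\<^sub>v unit_vec (Suc m) 0 = _\<close> by (auto simp: unit_vec_def split: if_splits)
  qed
  define C where "C = mat m m (\<lambda>(i, j). B $$ (Suc i, Suc j))"
  have C: "C \<in> carrier_mat m m" by (simp add: C_def)
  have symB': "B $$ (i, j) = B $$ (j, i)" if "i < Suc m" "j < Suc m" for i j
    using symB that B by (metis carrier_matD index_transpose_mat(1))
  have symC: "C\<^sup>T = C" by (rule eq_matI) (auto simp: C_def intro: symB')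
  obtain U d where Ud: "similar_mat_wit C (mat_diag m d) U U\<^sup>T"
    using Suc.IH[OF C symC] by blast
  define V where "V = four_block_mat (1\<^sub>m 1) (0\<^sub>m 1 m) (0\<^sub>m m 1) U"
  define d' where "d' i = (case i of 0 \<Rightarrow> e | Suc j \<Rightarrow> d j)" for i
  let ?e = "mat 1 1 (\<lambda>_. e)"
  have U: "U \<in> carrier_mat m m" using similar_mat_witD2[OF C Ud] by auto
  have V: "V \<in> carrier_mat (Suc m) (Suc m)" using U by (auto simp: V_def)
  have Vt: "V\<^sup>T = four_block_mat (1\<^sub>m 1) (0\<^sub>m 1 m) (0\<^sub>m m 1) (U\<^sup>T)"
    unfolding V_def using U by (simp add: transpose_four_block_mat[of _ 1 1 _ m _ m])
  \<comment> \<open>The first column comes from the eigenvector equation, the first row from it by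
    symmetry.\<close>
  have Beq: "B = four_block_mat ?e (0\<^sub>m 1 m) (0\<^sub>m m 1) C"
    using B by (intro eq_matI) (auto simp: C_def col0 symB'[of 0])
  have Deq: "mat_diag (Suc m) d' = four_block_mat ?e (0\<^sub>m 1 m) (0\<^sub>m m 1) (mat_diag m d)"
    by (intro eq_matI) (auto simp: mat_diag_def d'_def split: nat.split)
  have "similar_mat_wit B (mat_diag (Suc m) d') V (V\<^sup>T)"
    unfolding Beq Deq Vt unfolding V_def
    by (rule similar_mat_wit_four_block[OF similar_mat_wit_refl[of ?e 1] Ud])
      (use U C in auto)
  moreover have "similar_mat_wit A B H H"
  proof (rule similar_mat_witI[of _ _ "Suc m"])
    have "H * B * H = (H * H) * A * (H * H)"
      unfolding B_def using H(1) A
      by (simp add: assoc_mult_mat[of _ "Suc m" "Suc m" _ "Suc m" _ "Suc m"])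
    then show "A = H * B * H" using H A by simp
  qed (use H A B in auto)
  ultimately have "similar_mat_wit A (mat_diag (Suc m) d') (H * V) (V\<^sup>T * H)"
    by (rule similar_mat_wit_trans[rotated])
  moreover have "V\<^sup>T * H = (H * V)\<^sup>T"
    using transpose_mult[OF H(1) V] H(2) by simp
  ultimately show ?case by metis
qed

section \<open>Counting eigenvalues by linear constraints\<close>

text \<open>Gaussian elimination, one equation of \<open>J\<close> at a time. Solutions are made
  zero outside \<open>I\<close> so that sums over larger index sets can later be restricted to
  \<open>I\<close>.\<close>

lemma homogeneous_system_nontrivial_solution:
  fixes f :: "'b \<Rightarrow> 'a \<Rightarrow> 'c :: field"
  assumes "finite J" "finite I" "card J < card I"
  obtains x where "\<exists>i\<in>I. x i \<noteq> 0" "\<And>i. i \<notin> I \<Longrightarrow> x i = 0" "\<And>j. j \<in> J \<Longrightarrow> (\<Sum>i\<in>I. f j i * x i) = 0"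
proof -
  have "\<exists>x. (\<exists>i\<in>I. x i \<noteq> 0) \<and> (\<forall>i. i \<notin> I \<longrightarrow> x i = 0) \<and> (\<forall>j\<in>J. (\<Sum>i\<in>I. f j i * x i) = 0)"
    using assms
  proof (induction J arbitrary: I f rule: finite_induct)
    case empty
    then obtain i where "i \<in> I" by fastforce
    then show ?case by (intro exI[of _ "\<lambda>k. if k = i then 1 else 0"]) auto
  next
    case (insert b J)
    show ?case
    proof (cases "\<forall>i\<in>I. f b i = 0")
      case True
      have "card J < card I" using insert by simp
      from insert.IH[OF insert.prems(1) this, of f] show ?thesis using True by auto
    next
      case False
      then obtain p where p: "p \<in> I" "f b p \<noteq> 0" by blast
      \<comment> \<open>Equation \<open>b\<close> eliminates the unknown \<open>p\<close>:
        \<open>g\<close> holds the coefficients of the other equations after the substitution, and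
        \<open>q\<close> below restores the value at \<open>p\<close>.\<close>
      define g where "g j i = f j i - f j p * f b i / f b p" for j i
      have "card J < card (I - {p})" using insert p by simp
      then obtain y where y: "\<exists>i\<in>I - {p}. y i \<noteq> 0" "\<forall>i. i \<notin> I - {p} \<longrightarrow> y i = 0"
        "\<forall>j\<in>J. (\<Sum>i\<in>I - {p}. g j i * y i) = 0"
        using insert.IH[of "I - {p}" g] insert.prems(1) by auto
      define q where "q = - (\<Sum>i\<in>I - {p}. f b i * y i) / f b p"
      define x where "x = y(p := q)"
      have split: "(\<Sum>i\<in>I. f j i * x i) = f j p * q + (\<Sum>i\<in>I - {p}. f j i * y i)" for j
      proof -
        have "(\<Sum>i\<in>I. f j i * x i) = f j p * x p + (\<Sum>i\<in>I - {p}. f j i * x i)"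
          using p insert.prems(1) by (simp add: sum.remove)
        also have "(\<Sum>i\<in>I - {p}. f j i * x i) = (\<Sum>i\<in>I - {p}. f j i * y i)"
          by (rule sum.cong) (auto simp: x_def)
        finally show ?thesis by (simp add: x_def)
      qed
      have "(\<Sum>i\<in>I. f j i * x i) = 0" if "j \<in> J" for j
      proof -
        have "(\<Sum>i\<in>I - {p}. g j i * y i) =
            (\<Sum>i\<in>I - {p}. f j i * y i) - f j p / f b p * (\<Sum>i\<in>I - {p}. f b i * y i)"
          by (simp add: g_def left_diff_distrib sum_subtractf sum_distrib_left mult.assoc)
        then show ?thesis using y(3) that p(2) by (simp add: split q_def)
      qed
      moreover have "(\<Sum>i\<in>I. f b i * x i) = 0" using p(2) by (simp add: split q_def)
      ultimately show ?thesis using y(1,2) p(1) by (intro exI[of _ x]) (auto simp: x_def)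
    qed
  qed
  then show thesis using that by blast
qed

text \<open>With \<open>u i k\<close> the coordinate \<open>k\<close> of the \<open>i\<close>-th
  eigenvector, \<open>orth\<close> and \<open>complete\<close> are the two identities of an
  orthogonal matrix. Functions on indices reduce later arguments to finite double sums.\<close>

locale eigenbasis =
  fixes n :: nat and a :: "nat \<Rightarrow> nat \<Rightarrow> real" and u :: "nat \<Rightarrow> nat \<Rightarrow> real" and d :: "nat \<Rightarrow> real"
  assumes orth: "i < n \<Longrightarrow> j < n \<Longrightarrow> (\<Sum>k<n. u i k * u j k) = (if i = j then 1 else 0)"
    and complete: "k < n \<Longrightarrow> l < n \<Longrightarrow> (\<Sum>i<n. u i k * u i l) = (if k = l then 1 else 0)"
    and eig: "i < n \<Longrightarrow> k < n \<Longrightarrow> (\<Sum>j<n. a k j * u i j) = d i * u i k"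
begin

lemma uminus: "eigenbasis n (\<lambda>i j. - a i j) u (\<lambda>i. - d i)"
  by unfold_locales (auto simp: orth complete eig sum_negf)

lemma spectral_expansion:
  assumes "k < n" "l < n"
  shows "a k l = (\<Sum>i<n. d i * u i k * u i l)"
proof -
  have "(\<Sum>i<n. d i * u i k * u i l) = (\<Sum>i<n. \<Sum>j<n. a k j * (u i j * u i l))"
    using assms by (simp flip: eig add: sum_distrib_right mult.assoc)
  also have "\<dots> = (\<Sum>j<n. a k j * (\<Sum>i<n. u i j * u i l))"
    by (subst sum.swap) (simp add: sum_distrib_left)
  also have "\<dots> = (\<Sum>j<n. if j = l then a k l else 0)"
    by (rule sum.cong) (use assms complete in auto)
  finally show ?thesis using assms by simp
qed

lemma quadratic_form_expansion:
  "(\<Sum>k<n. \<Sum>l<n. a k l * x k * x l) = (\<Sum>i<n. d i * (\<Sum>k<n. u i k * x k)\<^sup>2)"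
proof -
  have "(\<Sum>k<n. \<Sum>l<n. a k l * x k * x l) = (\<Sum>k<n. \<Sum>l<n. \<Sum>i<n. d i * (u i k * x k * (u i l * x l)))"
    by (intro sum.cong refl) (simp add: spectral_expansion sum_distrib_right sum_distrib_left mult_ac)
  also have "\<dots> = (\<Sum>k<n. \<Sum>i<n. \<Sum>l<n. d i * (u i k * x k * (u i l * x l)))"
    by (intro sum.cong refl sum.swap)
  also have "\<dots> = (\<Sum>i<n. \<Sum>k<n. \<Sum>l<n. d i * (u i k * x k * (u i l * x l)))"
    by (rule sum.swap)
  also have "\<dots> = (\<Sum>i<n. d i * (\<Sum>k<n. u i k * x k)\<^sup>2)"
    unfolding power2_eq_square sum_product by (simp add: sum_distrib_left)
  finally show ?thesis .
qed

text \<open>The form is positive definite on the span of the eigenvectors with positive eigenvalue.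
  Were there more than \<open>card J\<close> of them, some nonzero vector of that span would meet
  all constraints.\<close>

lemma card_positive_le:
  assumes J: "finite J"
    and nonpos: "\<And>x. (\<forall>j\<in>J. (\<Sum>k<n. f j k * x k) = 0) \<Longrightarrow> (\<Sum>k<n. \<Sum>l<n. a k l * x k * x l) \<le> 0"
  shows "card {i. i < n \<and> d i > 0} \<le> card J"
proof (rule ccontr)
  let ?P = "{i. i < n \<and> d i > 0}"
  assume "\<not> ?thesis"
  then obtain c where c: "\<exists>i\<in>?P. c i \<noteq> 0" "\<And>i. i \<notin> ?P \<Longrightarrow> c i = 0"
    "\<And>j. j \<in> J \<Longrightarrow> (\<Sum>i\<in>?P. (\<Sum>k<n. f j k * u i k) * c i) = 0"
    using homogeneous_system_nontrivial_solution[OF J, of ?P "\<lambda>j i. \<Sum>k<n. f j k * u i k"] by auto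
  define x where "x k = (\<Sum>i\<in>?P. c i * u i k)" for k
  have x: "x k = (\<Sum>i<n. c i * u i k)" for k
    unfolding x_def by (rule sum.mono_neutral_left) (use c(2) in auto)
  have "(\<Sum>k<n. f j k * x k) = 0" if "j \<in> J" for j
  proof -
    have "(\<Sum>k<n. f j k * x k) = (\<Sum>i\<in>?P. \<Sum>k<n. f j k * u i k * c i)"
      unfolding x_def by (subst sum.swap) (simp add: sum_distrib_left mult_ac)
    then show ?thesis using c(3)[OF that] by (simp add: sum_distrib_right)
  qed
  then have "(\<Sum>i<n. d i * (\<Sum>k<n. u i k * x k)\<^sup>2) \<le> 0"
    using nonpos[of x] by (simp add: quadratic_form_expansion)
  \<comment> \<open>Orthonormality recovers the coefficient \<open>c i\<close>, so the form at
    \<open>x\<close> is a sum of nonnegative terms, one of them positive.\<close>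
  moreover have "(\<Sum>k<n. u i k * x k) = c i" if "i < n" for i
  proof -
    have "(\<Sum>k<n. u i k * x k) = (\<Sum>j<n. c j * (\<Sum>k<n. u i k * u j k))"
      unfolding x sum_distrib_left by (subst sum.swap) (simp add: mult_ac)
    also have "\<dots> = (\<Sum>j<n. if j = i then c i else 0)"
      by (rule sum.cong) (use that orth in auto)
    finally show ?thesis using that by simp
  qed
  ultimately have "(\<Sum>i<n. d i * (c i)\<^sup>2) \<le> 0" by simp
  moreover obtain i where "i \<in> ?P" "c i \<noteq> 0" using c(1) by blast
  then have "(\<Sum>i<n. d i * (c i)\<^sup>2) > 0"
  proof (intro sum_pos2[of _ i])
    show "0 \<le> d k * (c k)\<^sup>2" if "k \<in> {..<n}" for k
      using c(2)[of k] that by (cases "d k > 0") auto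
  qed auto
  ultimately show False by simp
qed

lemma card_negative_le:
  assumes J: "finite J"
    and nonneg: "\<And>x. (\<forall>j\<in>J. (\<Sum>k<n. f j k * x k) = 0) \<Longrightarrow> (\<Sum>k<n. \<Sum>l<n. a k l * x k * x l) \<ge> 0"
  shows "card {i. i < n \<and> d i < 0} \<le> card J"
  using eigenbasis.card_positive_le[OF uminus J, of f] nonneg by (simp add: sum_negf)

text \<open>Otherwise dimension counting yields a nonzero vector supported on \<open>W\<close> and
  orthogonal to every eigenvector with nonzero eigenvalue; by the spectral expansion it lies in the
  kernel.\<close>

lemma card_nonzero_ge:
  assumes W: "W \<subseteq> {..<n}"
    and inj: "\<And>x. (\<And>k. k \<notin> W \<Longrightarrow> x k = 0) \<Longrightarrow> (\<And>k. k < n \<Longrightarrow> (\<Sum>l<n. a k l * x l) = 0) \<Longrightarrow>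
      (\<And>k. k \<in> W \<Longrightarrow> x k = 0)"
  shows "card W \<le> card {i. i < n \<and> d i \<noteq> 0}"
proof (rule ccontr)
  let ?N = "{i. i < n \<and> d i \<noteq> 0}"
  assume "\<not> ?thesis"
  then obtain x where x: "\<exists>k\<in>W. x k \<noteq> 0" "\<And>k. k \<notin> W \<Longrightarrow> x k = 0"
    "\<And>i. i \<in> ?N \<Longrightarrow> (\<Sum>k\<in>W. u i k * x k) = 0"
    using homogeneous_system_nontrivial_solution[of ?N W u] finite_subset[OF W] by auto
  have 0: "d i * (\<Sum>l<n. u i l * x l) = 0" if "i < n" for i
  proof -
    have "(\<Sum>k<n. u i k * x k) = (\<Sum>k\<in>W. u i k * x k)"
      by (rule sum.mono_neutral_right) (use W x(2) in auto)
    then show ?thesis using x(3)[of i] that by (cases "d i = 0") auto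
  qed
  have "(\<Sum>l<n. a k l * x l) = 0" if "k < n" for k
  proof -
    have "(\<Sum>l<n. a k l * x l) = (\<Sum>l<n. \<Sum>i<n. u i k * (d i * (u i l * x l)))"
      using that by (intro sum.cong refl) (simp add: spectral_expansion sum_distrib_right sum_distrib_left mult_ac)
    also have "\<dots> = (\<Sum>i<n. u i k * (d i * (\<Sum>l<n. u i l * x l)))"
      by (subst sum.swap) (simp add: sum_distrib_left)
    also have "\<dots> = 0" using 0 by (intro sum.neutral) auto
    finally show ?thesis .
  qed
  then show False using inj[of x] x by blast
qed

lemma card_nonzero: "card {i. i < n \<and> d i \<noteq> 0} = card {i. i < n \<and> d i > 0} + card {i. i < n \<and> d i < 0}"
proof -
  have "{i. i < n \<and> d i > 0} \<inter> {i. i < n \<and> d i < 0} = {}" by auto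
  moreover have "{i. i < n \<and> d i \<noteq> 0} = {i. i < n \<and> d i > 0} \<union> {i. i < n \<and> d i < 0}" by auto
  ultimately show ?thesis by (metis card_Un_disjoint finite_Collect_conjI finite_Collect_less_nat)
qed

end

section \<open>Inertia read off a diagonalisation\<close>

lemma order_linear_factors:
  fixes d :: "nat \<Rightarrow> 'a :: idom"
  shows "order c (\<Prod>i<n. [:- d i, 1:]) = card {i. i < n \<and> d i = c}"
proof (induction n)
  case (Suc n)
  have "{i. i < Suc n \<and> d i = c} = (if d n = c then insert n else id) {i. i < n \<and> d i = c}"
    by (auto simp: less_Suc_eq)
  moreover have "order c [:- d n, 1:] = (if d n = c then 1 else 0)"
    by (auto simp: order_linear' intro: order_0I)
  moreover have "(\<Prod>i<n. [:- d i, 1:]) * [:- d n, 1:] \<noteq> 0"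
    by (simp add: prod_zero_iff del: mult_pCons_right)
  ultimately show ?case using Suc by (simp add: order_mult del: mult_pCons_right)
qed simp

text \<open>The columns of \<open>U\<close> are the eigenvectors. The characteristic polynomial is
  the product of the linear factors for \<open>d\<close>, so multiplicities are sizes of fibres of
  \<open>d\<close>.\<close>

lemma pos_inertia_eigenbasis:
  assumes A: "A \<in> carrier_mat n n" and sym: "A\<^sup>T = A"
  obtains u d where "eigenbasis n (\<lambda>i j. A $$ (i, j)) u d" "pos_inertia A = card {i. i < n \<and> d i > 0}"
proof -
  obtain U d where sim: "similar_mat_wit A (mat_diag n d) U U\<^sup>T"
    using real_symmetric_diagonalization[OF A sym] by blast
  note U = similar_mat_witD2[OF A sim]
  define u where "u i k = U $$ (k, i)" for i k
  have "A * U = (U * mat_diag n d) * U\<^sup>T * U" using U(3) by simp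
  also have "\<dots> = (U * mat_diag n d) * (U\<^sup>T * U)"
    by (rule assoc_mult_mat[of _ n n _ n _ n]) (use U in auto)
  finally have AU: "A * U = U * mat_diag n d" using U(2,6) by (simp add: right_mult_one_mat[of _ n n])
  have "eigenbasis n (\<lambda>i j. A $$ (i, j)) u d"
  proof
    fix i j assume "i < n" "j < n"
    then show "(\<Sum>k<n. u i k * u j k) = (if i = j then 1 else 0)"
      using arg_cong[OF U(2), of "\<lambda>M. M $$ (i, j)"] U(6)
      by (simp add: u_def scalar_prod_def atLeast0LessThan)
  next
    fix i j assume "i < n" "j < n"
    then show "(\<Sum>k<n. u k i * u k j) = (if i = j then 1 else 0)"
      using arg_cong[OF U(1), of "\<lambda>M. M $$ (i, j)"] U(6)
      by (simp add: u_def scalar_prod_def atLeast0LessThan)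
  next
    fix i k assume ik: "i < n" "k < n"
    have "(A * U) $$ (k, i) = (\<Sum>j<n. A $$ (k, j) * u i j)"
      using ik A U(6) by (simp add: u_def scalar_prod_def atLeast0LessThan)
    moreover have "(U * mat_diag n d) $$ (k, i) = d i * u i k"
      using ik U(6) by (simp add: mat_diag_mult_right[of _ n] u_def)
    ultimately show "(\<Sum>j<n. A $$ (k, j) * u i j) = d i * u i k" using AU by simp
  qed
  moreover have cp: "char_poly A = (\<Prod>i<n. [:- d i, 1:])"
  proof -
    have "char_poly A = char_poly (mat_diag n d)"
      using sim by (intro char_poly_similar) (auto simp: similar_mat_def)
    also have "\<dots> = (\<Prod>x\<leftarrow>diag_mat (mat_diag n d). [:- x, 1:])"
      by (rule char_poly_upper_triangular[of _ n]) (auto simp: mat_diag_def)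
    also have "diag_mat (mat_diag n d) = map d [0..<n]"
      by (auto simp: diag_mat_def mat_diag_def intro!: nth_equalityI)
    also have "(\<Prod>x\<leftarrow>map d [0..<n]. [:- x, 1:]) = (\<Prod>i<n. [:- d i, 1:])"
      by (induction n) (simp_all add: mult.commute del: mult_pCons_left mult_pCons_right)
    finally show ?thesis .
  qed
  moreover have "pos_inertia A = card {i. i < n \<and> d i > 0}"
  proof -
    \<comment> \<open>The positive roots are the positive values of \<open>d\<close>; their fibres
      partition the indices with positive value.\<close>
    have "pos_inertia A = (\<Sum>c\<in>d ` {i. i < n \<and> d i > 0}. card {i. i < n \<and> d i = c})"
      unfolding pos_inertia_def cp order_linear_factors
      by (rule sum.cong) (auto simp: poly_prod)
    also have "\<dots> = card (\<Union>c\<in>d ` {i. i < n \<and> d i > 0}. {i. i < n \<and> d i = c})"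
      by (rule card_UN_disjoint[symmetric]) auto
    also have "(\<Union>c\<in>d ` {i. i < n \<and> d i > 0}. {i. i < n \<and> d i = c}) = {i. i < n \<and> d i > 0}"
      by auto
    finally show ?thesis .
  qed
  ultimately show thesis using that by blast
qed

section \<open>Canonical signed unicyclic graphs\<close>

locale canonical_signed_graph =
  fixes n :: nat and E :: "nat \<Rightarrow> nat \<Rightarrow> bool" and sg :: "nat \<Rightarrow> nat \<Rightarrow> real" and cs :: "nat list"
  assumes signed: "signed_graph n E sg"
    and canonical: "canonical_unicyclic n E"
    and cycle: "is_cycle n E cs"
begin

abbreviation g :: nat where "g \<equiv> length cs"

text \<open>Positions are read modulo \<open>g\<close>, so that \<open>Suc\<close> is a step along
  the cycle at every position.\<close>

definition cv :: "nat \<Rightarrow> nat" where "cv p = cs ! (p mod g)"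

definition s :: "nat \<Rightarrow> real" where "s p = sg (cv p) (cv (Suc p))"

definition a :: "nat \<Rightarrow> nat \<Rightarrow> real" where "a i j = (if E i j then sg i j else 0)"

section \<open>Positions and adjacency on the cycle\<close>

lemma g_ge_3: "3 \<le> g" and distinct_cs: "distinct cs" and cs_lt: "set cs \<subseteq> {..<n}"
  using cycle unfolding is_cycle_def by auto

lemma edgeD: "E i j \<Longrightarrow> i < n \<and> j < n \<and> i \<noteq> j \<and> E j i"
  and sg_sym: "E i j \<Longrightarrow> sg i j = sg j i"
  and sg_sign: "E i j \<Longrightarrow> sg i j = 1 \<or> sg i j = -1"
  using signed unfolding signed_graph_def by blast+

lemma cv_in [simp]: "cv p \<in> set cs"
  unfolding cv_def using g_ge_3 by (intro nth_mem mod_less_divisor) linarith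

lemma cv_lt [simp]: "cv p < n" using cv_in cs_lt by blast

lemma cv_mod [simp]: "cv (p mod g) = cv p" by (simp add: cv_def)

lemma cv_add_g [simp]: "cv (p + g) = cv p" by (simp add: cv_def)

lemma cv_eq_iff: "cv p = cv q \<longleftrightarrow> p mod g = q mod g"
  unfolding cv_def using distinct_cs g_ge_3
  by (subst nth_eq_iff_index_eq) (auto intro!: mod_less_divisor)

lemma set_cs: "set cs = cv ` {..<g}"
  by (auto simp: cv_def in_set_conv_nth image_iff Bex_def)

lemma in_cs_obtain:
  assumes "v \<in> set cs"
  obtains p where "p < g" "v = cv p"
  using assms unfolding set_cs by blast

lemma inj_cv: "inj_on cv {..<g}"
  by (rule inj_onI) (simp add: cv_eq_iff)

lemma cv_Suc_eq_iff: "cv (Suc p) = cv (Suc q) \<longleftrightarrow> cv p = cv q"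
proof
  assume "cv (Suc p) = cv (Suc q)"
  then have "(Suc p + (g - 1)) mod g = (Suc q + (g - 1)) mod g"
    unfolding cv_eq_iff by (intro mod_add_cong) auto
  moreover have "Suc r + (g - 1) = r + g" for r using g_ge_3 by simp
  ultimately have "(p + g) mod g = (q + g) mod g" by metis
  then show "cv p = cv q" unfolding cv_eq_iff by simp
next
  assume "cv p = cv q"
  then show "cv (Suc p) = cv (Suc q)" unfolding cv_eq_iff by (metis mod_Suc_eq)
qed

text \<open>Rests on \<open>g \<ge> 3\<close>; it keeps apart the two cycle terms in a row of the
  matrix.\<close>

lemma cv_neq_two_steps: "cv p \<noteq> cv (Suc (Suc p))"
proof
  assume "cv p = cv (Suc (Suc p))"
  then have "g dvd Suc (Suc p) - p"
    unfolding cv_eq_iff by (metis mod_eq_dvd_iff_nat le_add2 add_2_eq_Suc)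
  then show False using g_ge_3 by (auto dest!: dvd_imp_le)
qed

lemma edge_cv: "E (cv p) (cv (Suc p))"
proof -
  have "p mod g < g" using g_ge_3 by (intro mod_less_divisor) linarith
  then have "E (cs ! (p mod g)) (cs ! ((p mod g + 1) mod g))"
    using cycle unfolding is_cycle_def by blast
  then show ?thesis by (simp add: cv_def mod_Suc_eq)
qed

lemma s_sign: "s p = 1 \<or> s p = -1" unfolding s_def using sg_sign edge_cv by blast

lemma s_sq [simp]: "s p * s p = 1" and s_nz [simp]: "s p \<noteq> 0" using s_sign[of p] by auto

lemma s_add_g [simp]: "s (p + g) = s p"
  using cv_add_g[of p] cv_add_g[of "Suc p"] by (simp add: s_def)

text \<open>An edge between nonconsecutive positions closes the arc \<open>ds\<close> from
  \<open>p\<close> to \<open>q\<close> to a cycle. By unicyclicity this has the same edges as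
  \<open>cs\<close>, so the closing edge is itself one of them.\<close>

lemma chordless_less:
  assumes "p < q" "q < g" "E (cv p) (cv q)"
  shows "cv q = cv (Suc p) \<or> cv p = cv (Suc q)"
proof (cases "q = Suc p")
  case False
  define ds where "ds = map cv [p..<Suc q]"
  have len: "length ds = Suc (q - p)" using assms by (simp add: ds_def)
  have nth: "ds ! i = cv (p + i)" if "i \<le> q - p" for i
    using that assms by (simp add: ds_def del: upt_Suc)
  have cyc: "is_cycle n E ds"
    unfolding is_cycle_def
  proof (intro conjI allI impI)
    show "3 \<le> length ds" using False assms by (simp add: len)
    have "{p..<Suc q} \<subseteq> {..<g}" using assms by auto
    then show "distinct ds" unfolding ds_def distinct_map
      using inj_on_subset[OF inj_cv] by (simp del: upt_Suc)
    show "set ds \<subseteq> {..<n}" by (auto simp: ds_def)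
    fix i assume i: "i < length ds"
    show "E (ds ! i) (ds ! ((i + 1) mod length ds))"
    proof (cases "i = q - p")
      case True
      then show ?thesis using nth[of 0] nth[of i] assms edgeD by (simp add: len)
    next
      case False
      then show ?thesis using i nth[of i] nth[of "Suc i"] edge_cv by (simp add: len)
    qed
  qed
  have "{ds ! (q - p), ds ! ((q - p + 1) mod length ds)} \<in> cycle_edges ds"
    unfolding cycle_edges_def by (intro CollectI exI[of _ "q - p"] conjI refl) (simp add: len)
  then have "{cv q, cv p} \<in> cycle_edges ds" using nth[of 0] nth[of "q - p"] assms by (simp add: len)
  also have "cycle_edges ds = cycle_edges cs"
    using canonical cyc cycle unfolding canonical_unicyclic_def unicyclic_def by blast
  finally obtain i where "i < g" "{cv q, cv p} = {cs ! i, cs ! ((i + 1) mod g)}"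
    unfolding cycle_edges_def by blast
  then have "{cv q, cv p} = {cv i, cv (Suc i)}" by (simp add: cv_def)
  then show ?thesis unfolding doubleton_eq_iff using cv_Suc_eq_iff by metis
qed simp

lemma chordless:
  assumes "E (cv p) (cv q)"
  shows "cv q = cv (Suc p) \<or> cv p = cv (Suc q)"
proof -
  have lt: "r mod g < g" for r using g_ge_3 by (intro mod_less_divisor) linarith
  have *: "cv (Suc (r mod g)) = cv (Suc r)" for r by (simp add: cv_Suc_eq_iff)
  have "p mod g \<noteq> q mod g" using edgeD[OF assms] cv_eq_iff by auto
  then consider "p mod g < q mod g" | "q mod g < p mod g" by linarith
  then show ?thesis
    using chordless_less[of "p mod g" "q mod g"] chordless_less[of "q mod g" "p mod g"] lt
      assms edgeD[OF assms] * by cases auto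
qed

lemma cycle_neighbours:
  assumes "E (cv (Suc p)) (cv q)"
  shows "cv q = cv p \<or> cv q = cv (Suc (Suc p))"
  using chordless[OF assms] cv_Suc_eq_iff by auto

lemma outside_unique_neighbour:
  assumes "v < n" "v \<notin> set cs"
  obtains u where "u \<in> set cs" "E v u" "\<And>w. w \<in> set cs \<Longrightarrow> E v w \<Longrightarrow> w = u"
proof -
  have "card {u \<in> set cs. E v u} = 1"
    using canonical cycle assms unfolding canonical_unicyclic_def by blast
  then obtain u where "{u \<in> set cs. E v u} = {u}" by (auto simp: card_1_singleton_iff)
  then show thesis using that by blast
qed

lemma outside_independent: "E u v \<Longrightarrow> u \<in> set cs \<or> v \<in> set cs"
  using canonical cycle edgeD unfolding canonical_unicyclic_def by blast

text \<open>Centring the row at \<open>Suc p\<close> names both cycle neighbours without subtracting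
  on positions.\<close>

lemma row_cycle_vertex:
  "(\<Sum>l<n. a (cv (Suc p)) l * x l) =
    s p * x (cv p) + s (Suc p) * x (cv (Suc (Suc p))) + (\<Sum>l\<in>{..<n} - set cs. a (cv (Suc p)) l * x l)"
proof -
  let ?t = "\<lambda>l. a (cv (Suc p)) l * x l"
  have "sum ?t {..<n} = sum ?t ({..<n} - set cs) + sum ?t (set cs)"
    by (rule sum.subset_diff) (use cs_lt in auto)
  also have "sum ?t (set cs) = sum ?t {cv p, cv (Suc (Suc p))}"
  proof (rule sum.mono_neutral_right)
    show "\<forall>i\<in>set cs - {cv p, cv (Suc (Suc p))}. ?t i = 0"
      using cycle_neighbours by (auto simp: a_def elim!: in_cs_obtain)
  qed auto
  also have "\<dots> = ?t (cv p) + ?t (cv (Suc (Suc p)))"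
    using cv_neq_two_steps by simp
  also have "a (cv (Suc p)) (cv p) = s p"
    using edge_cv[of p] edgeD sg_sym by (simp add: a_def s_def)
  also have "a (cv (Suc p)) (cv (Suc (Suc p))) = s (Suc p)"
    using edge_cv[of "Suc p"] by (simp add: a_def s_def)
  finally show ?thesis by simp
qed

lemma row_minor_vertex:
  assumes "\<not> major_vertex n E cs (cv (Suc p))"
  shows "(\<Sum>l<n. a (cv (Suc p)) l * x l) = s p * x (cv p) + s (Suc p) * x (cv (Suc (Suc p)))"
proof -
  have "(\<Sum>l\<in>{..<n} - set cs. a (cv (Suc p)) l * x l) = 0"
    using assms by (intro sum.neutral) (auto simp: major_vertex_def a_def)
  then show ?thesis by (simp add: row_cycle_vertex)
qed

lemma adj_matrix_eigenbasis:
  obtains u d where "eigenbasis n a u d" "pos_inertia (adj_matrix n E sg) = card {i. i < n \<and> d i > 0}"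
proof -
  let ?A = "adj_matrix n E sg"
  have A: "?A \<in> carrier_mat n n" by (simp add: adj_matrix_def)
  have Aa: "?A $$ (i, j) = a i j" if "i < n" "j < n" for i j
    using that by (simp add: adj_matrix_def a_def)
  have "?A\<^sup>T = ?A"
    using edgeD sg_sym by (intro eq_matI) (auto simp: adj_matrix_def)
  then obtain u d where ud: "eigenbasis n (\<lambda>i j. ?A $$ (i, j)) u d"
    "pos_inertia ?A = card {i. i < n \<and> d i > 0}"
    using pos_inertia_eigenbasis[OF A] by blast
  have "eigenbasis n a u d"
    using ud(1) unfolding eigenbasis_def by (simp add: Aa)
  then show thesis using that ud(2) by blast
qed

section \<open>Vertex covers as bounds on the inertia\<close>

lemma quadratic_form_vertex_cover:
  assumes "\<And>i j. E i j \<Longrightarrow> i \<in> S \<or> j \<in> S" "\<And>i. i \<in> S \<Longrightarrow> x i = 0"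
  shows "(\<Sum>k<n. \<Sum>l<n. a k l * x k * x l) = 0"
  using assms by (intro sum.neutral ballI) (auto simp: a_def)

lemma
  assumes "eigenbasis n a u d"
    and S: "S \<subseteq> {..<n}" and cover: "\<And>i j. E i j \<Longrightarrow> i \<in> S \<or> j \<in> S"
  shows card_positive_le_vertex_cover: "card {i. i < n \<and> d i > 0} \<le> card S"
    and card_negative_le_vertex_cover: "card {i. i < n \<and> d i < 0} \<le> card S"
proof -
  interpret eigenbasis n a u d by fact
  \<comment> \<open>Evaluation at the vertices of the cover; on the common kernel the form is zero,
    which gives both bounds at once.\<close>
  let ?f = "\<lambda>j k. if k = j then 1 else 0 :: real"
  have fin: "finite S" using S finite_subset by blast
  have f: "(\<Sum>k<n. ?f j k * x k) = x j" if "j \<in> S" for j and x :: "nat \<Rightarrow> real"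
  proof -
    have "(\<Sum>k<n. ?f j k * x k) = (\<Sum>k<n. if k = j then x j else 0)" by (rule sum.cong) auto
    then show ?thesis using that S by auto
  qed
  have Q: "(\<Sum>k<n. \<Sum>l<n. a k l * x k * x l) = 0" if "\<forall>j\<in>S. (\<Sum>k<n. ?f j k * x k) = 0" for x
    by (rule quadratic_form_vertex_cover[OF cover]) (use that f in auto)
  show "card {i. i < n \<and> d i > 0} \<le> card S"
    by (rule card_positive_le[OF fin, of ?f]) (simp only: Q order_refl)
  show "card {i. i < n \<and> d i < 0} \<le> card S"
    by (rule card_negative_le[OF fin, of ?f]) (simp only: Q order_refl)
qed

text \<open>Each sign has at most \<open>card S\<close> eigenvalues and at least
  \<open>2 * card S\<close> are nonzero, so both bounds are attained.\<close>

lemma pos_inertia_eq_vertex_cover: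
  assumes S: "S \<subseteq> {..<n}" and cover: "\<And>i j. E i j \<Longrightarrow> i \<in> S \<or> j \<in> S"
    and W: "W \<subseteq> {..<n}" "card W = 2 * card S"
    and inj: "\<And>x k. (\<And>k. k \<notin> W \<Longrightarrow> x k = 0) \<Longrightarrow> (\<And>k. k < n \<Longrightarrow> (\<Sum>l<n. a k l * x l) = 0) \<Longrightarrow>
      k \<in> W \<Longrightarrow> x k = 0"
  shows "pos_inertia (adj_matrix n E sg) = card S"
proof -
  obtain u d where ud: "eigenbasis n a u d"
    "pos_inertia (adj_matrix n E sg) = card {i. i < n \<and> d i > 0}"
    by (rule adj_matrix_eigenbasis)
  interpret eigenbasis n a u d by fact
  have "card W \<le> card {i. i < n \<and> d i \<noteq> 0}"
    by (rule card_nonzero_ge[OF W(1)]) (rule inj)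
  then show ?thesis
    using card_positive_le_vertex_cover[OF ud(1) S cover]
      card_negative_le_vertex_cover[OF ud(1) S cover] card_nonzero W(2) ud(2) by simp
qed

section \<open>Signed cycles\<close>

definition \<tau> :: real where "\<tau> = (\<Prod>p<g. s p)"

lemma prod_s_sign: "(\<Prod>p\<in>I. s p) = 1 \<or> (\<Prod>p\<in>I. s p) = -1"
proof (induction I rule: infinite_finite_induct)
  case (insert p I)
  then show ?case using s_sign[of p] by auto
qed auto

lemma tau_sign: "\<tau> = 1 \<or> \<tau> = -1"
  unfolding \<tau>_def by (rule prod_s_sign)

lemma balanced_iff: "balanced_cycle sg cs \<longleftrightarrow> \<tau> = 1"
proof -
  have "(\<Prod>i<g. sg (cs ! i) (cs ! ((i + 1) mod g))) = \<tau>"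
    unfolding \<tau>_def by (rule prod.cong) (auto simp: s_def cv_def)
  then show ?thesis by (simp add: balanced_cycle_def)
qed

text \<open>Moving the window by one exchanges \<open>s p\<close> for \<open>s (p + g)\<close>,
  which is the same sign. This lets a walk round the cycle start anywhere.\<close>

lemma prod_s_shift: "(\<Prod>j<g. s (p + j)) = \<tau>"
proof (induction p)
  case (Suc p)
  have "s p * (\<Prod>j<g. s (Suc p + j)) = (\<Prod>j<Suc g. s (p + j))"
    by (simp only: prod.lessThan_Suc_shift) simp
  also have "\<dots> = s p * (\<Prod>j<g. s (p + j))" by (simp add: mult.commute)
  finally show ?case using Suc by simp
qed (simp add: \<tau>_def)

text \<open>Up to scaling, the unique vector on the even positions that is annihilated by the
  adjacency equations of the odd positions.\<close>

definition alt :: "nat \<Rightarrow> real" where "alt i = (-1) ^ i * (\<Prod>j<2 * i. s j)"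

lemma alt_0 [simp]: "alt 0 = 1" by (simp add: alt_def)

lemma alt_Suc: "s (2 * i) * alt i + s (Suc (2 * i)) * alt (Suc i) = 0"
proof -
  have "s (Suc (2 * i)) * alt (Suc i) = - (s (Suc (2 * i)) * s (Suc (2 * i))) * (s (2 * i) * alt i)"
    by (simp add: alt_def del: s_sq)
  then show ?thesis by simp
qed

text \<open>The two edges at an odd position contribute a multiple of the left side of the row
  equation \<open>alt_Suc\<close>, hence nothing.\<close>

lemma alternating_path_sum_zero:
  assumes "\<And>i. i \<le> k \<Longrightarrow> x (cv (2 * i)) = alt i * x (cv 0)"
  shows "(\<Sum>p<2 * k. s p * x (cv p) * x (cv (Suc p))) = 0"
  using assms
proof (induction k)
  case (Suc k)
  have "s (2 * k) * x (cv (2 * k)) * x (cv (Suc (2 * k)))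
      + s (Suc (2 * k)) * x (cv (Suc (2 * k))) * x (cv (2 * Suc k))
    = x (cv (Suc (2 * k))) * x (cv 0) * (s (2 * k) * alt k + s (Suc (2 * k)) * alt (Suc k))"
    using Suc.prems[of k] Suc.prems[of "Suc k"] by (simp add: algebra_simps)
  then show ?case using Suc by (simp add: alt_Suc)
qed simp

text \<open>Presents the relation between \<open>x (cv (2 * j))\<close> and \<open>x (cv 0)\<close>
  as a linear functional, the shape in which the eigenvalue bounds take their constraints.\<close>

lemma alternating_functional:
  "(\<Sum>k<n. ((if k = cv (2 * j) then 1 else 0) - alt j * (if k = cv 0 then 1 else 0)) * x k)
    = x (cv (2 * j)) - alt j * x (cv 0)"
proof -
  have "(\<Sum>k<n. ((if k = cv (2 * j) then 1 else 0) - alt j * (if k = cv 0 then 1 else 0)) * x k)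
    = (\<Sum>k<n. (if k = cv (2 * j) then x (cv (2 * j)) else 0) - (if k = cv 0 then alt j * x (cv 0) else 0))"
    by (rule sum.cong) (auto simp: left_diff_distrib)
  then show ?thesis by (simp add: sum_subtractf)
qed

section \<open>Graphs that consist of the cycle alone\<close>

context
  assumes whole: "set cs = {..<n}"
begin

lemma g_eq_n: "g = n"
  using distinct_card[OF distinct_cs] whole by simp

lemma not_major: "\<not> major_vertex n E cs v"
  using whole by (auto simp: major_vertex_def)

lemmas row = row_minor_vertex[OF not_major]

text \<open>Each edge is seen from both ends. Reindexing by one position brings the rows to the form
  \<open>Suc p\<close> of the row formula.\<close>

lemma quadratic_form_cycle:
  "(\<Sum>k<n. \<Sum>l<n. a k l * x k * x l) = 2 * (\<Sum>p<g. s p * x (cv p) * x (cv (Suc p)))"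
proof -
  define h where "h p = x (cv p) * (\<Sum>l<n. a (cv p) l * x l)" for p
  define t where "t p = s p * x (cv p) * x (cv (Suc p))" for p
  have shift: "(\<Sum>p<g. w (Suc p)) = (\<Sum>p<g. w p)" if "w g = w 0" for w :: "nat \<Rightarrow> real"
    using sum.lessThan_Suc_shift[of w g] that by simp
  have cv_g: "cv g = cv 0" "cv (Suc g) = cv (Suc 0)" "s g = s 0"
    using cv_add_g[of 0] cv_add_g[of 1] s_add_g[of 0] by auto
  have "(\<Sum>k<n. \<Sum>l<n. a k l * x k * x l) = (\<Sum>k\<in>cv ` {..<g}. x k * (\<Sum>l<n. a k l * x l))"
    using whole set_cs by (simp add: sum_distrib_left mult_ac)
  also have "\<dots> = (\<Sum>p<g. h p)"
    by (simp add: sum.reindex[OF inj_cv] h_def)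
  also have "\<dots> = (\<Sum>p<g. h (Suc p))"
    by (rule shift[symmetric]) (simp add: h_def cv_g)
  also have "\<dots> = (\<Sum>p<g. t p + t (Suc p))"
    unfolding h_def t_def row by (rule sum.cong) (simp_all add: algebra_simps)
  also have "\<dots> = (\<Sum>p<g. t p) + (\<Sum>p<g. t p)"
    unfolding sum.distrib by (subst shift) (simp_all add: t_def cv_g)
  finally show ?thesis by (simp add: t_def)
qed

text \<open>The row equations determine the value two positions ahead. One round for even
  \<open>g\<close>, two rounds for odd \<open>g\<close>, return to \<open>p\<close> with total
  factor \<open>-1\<close>; over two rounds the signs multiply to
  \<open>\<tau> * \<tau> = 1\<close>.\<close>

lemma kernel_trivial:
  assumes "odd g \<or> (-1) ^ (g div 2) * \<tau> = -1"
    and ker: "\<And>k. k < n \<Longrightarrow> (\<Sum>l<n. a k l * x l) = 0"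
  shows "x (cv p) = 0"
proof -
  have step: "x (cv (Suc (Suc q))) = - (s q * s (Suc q) * x (cv q))" for q
  proof -
    have "s q * x (cv q) + s (Suc q) * x (cv (Suc (Suc q))) = 0"
      using ker[of "cv (Suc q)"] by (simp add: row)
    then show ?thesis using s_sign[of q] s_sign[of "Suc q"] by (elim disjE) simp_all
  qed
  have iter: "x (cv (p + 2 * i)) = (-1) ^ i * (\<Prod>j<2 * i. s (p + j)) * x (cv p)" for i
    by (induction i) (simp_all add: step)
  show ?thesis
  proof (cases "even g")
    case True
    then have "x (cv (p + g)) = (-1) ^ (g div 2) * \<tau> * x (cv p)"
      using iter[of "g div 2"] prod_s_shift[of p] by simp
    then show ?thesis using assms(1) True by simp
  next
    case False
    have "(\<Prod>j<g + k. s (p + j)) = (\<Prod>j<g. s (p + j)) * (\<Prod>j<k. s (p + g + j))" for k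
      by (induction k) (simp_all add: add.assoc)
    then have "(\<Prod>j<2 * g. s (p + j)) = (\<Prod>j<g. s (p + j)) * (\<Prod>j<g. s (p + g + j))"
      by (simp add: mult_2)
    also have "\<dots> = 1" using tau_sign unfolding prod_s_shift by auto
    finally have "x (cv (p + 2 * g)) = - x (cv p)" using iter[of g] False by simp
    moreover have "cv (p + 2 * g) = cv p" using cv_add_g[of "p + g"] by (simp add: mult_2 add.assoc)
    ultimately show ?thesis by simp
  qed
qed

text \<open>The even positions form a cover, so neither sign exceeds \<open>(g + 1) div 2\<close>;
  in the nonsingular cases the two counts add up to \<open>g\<close>. The functionals
  \<open>?f\<close> then settle the cases in which one sign falls short.\<close>

lemma pos_inertia_cycle:
  "pos_inertia (adj_matrix n E sg) = (g + 1) div 2 \<longleftrightarrow>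
    (-1) ^ (g div 2) * \<tau> = (if even g then -1 else 1)"
proof -
  obtain u d where ud: "eigenbasis n a u d"
    "pos_inertia (adj_matrix n E sg) = card {i. i < n \<and> d i > 0}"
    by (rule adj_matrix_eigenbasis)
  interpret eigenbasis n a u d by fact
  let ?pos = "card {i. i < n \<and> d i > 0}" and ?neg = "card {i. i < n \<and> d i < 0}"
  let ?\<epsilon> = "(-1) ^ (g div 2) * \<tau>"
  define m where "m = g div 2"
  let ?f = "\<lambda>j k. (if k = cv (2 * j) then 1 else 0) - alt j * (if k = cv 0 then 1 else 0)"
  have eps: "?\<epsilon> = 1 \<or> ?\<epsilon> = -1"
    using tau_sign by (cases "even (g div 2)") auto
  \<comment> \<open>For odd \<open>g\<close> this takes both ends \<open>0\<close> and
    \<open>g - 1\<close> of the closing edge, hence the rounding up.\<close>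
  define S where "S = (\<lambda>i. cv (2 * i)) ` {..<(g + 1) div 2}"
  have cover: "i \<in> S \<or> j \<in> S" if "E i j" for i j
  proof -
    have even_in: "cv p \<in> S" if "even p" "p < g" for p
      unfolding S_def using that by (intro image_eqI[of _ _ "p div 2"]) auto
    have S: "cv p \<in> S \<or> cv (Suc p) \<in> S" if "p < g" for p
    proof (cases "Suc p = g")
      case True
      then have "cv (Suc p) = cv 0" using cv_add_g[of 0] by simp
      then show ?thesis using even_in[of 0] g_ge_3 by (metis even_zero gr0I less_numeral_extra(3) not_numeral_le_zero)
    next
      case False
      then show ?thesis using even_in[of p] even_in[of "Suc p"] that by auto
    qed
    have "i \<in> set cs" "j \<in> set cs" using edgeD[OF that] whole by auto
    then obtain p q where pq: "p < g" "i = cv p" "q < g" "j = cv q" by (metis in_cs_obtain)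
    then show ?thesis using chordless[of p q] that S[of p] S[of q] by auto
  qed
  have "card S \<le> (g + 1) div 2" unfolding S_def using card_image_le[of "{..<(g + 1) div 2}"] by simp
  moreover have Sn: "S \<subseteq> {..<n}" by (auto simp: S_def)
  ultimately have ub: "?pos \<le> (g + 1) div 2" "?neg \<le> (g + 1) div 2"
    using card_positive_le_vertex_cover[OF ud(1) Sn cover]
      card_negative_le_vertex_cover[OF ud(1) Sn cover] by auto
  have full: "?pos + ?neg = g" if "odd g \<or> ?\<epsilon> = -1"
  proof -
    have "card {..<n} \<le> card {i. i < n \<and> d i \<noteq> 0}"
    proof (rule card_nonzero_ge)
      fix x k assume "\<And>k. k < n \<Longrightarrow> (\<Sum>l<n. a k l * x l) = 0" "k \<in> {..<n}"
      then show "x k = 0" using kernel_trivial[OF that, of x] whole in_cs_obtain by metis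
    qed simp
    moreover have "card {i. i < n \<and> d i \<noteq> 0} \<le> card {..<n}" by (rule card_mono) auto
    ultimately show ?thesis using card_nonzero g_eq_n by simp
  qed
  have alt_ext: "x (cv (2 * i)) = alt i * x (cv 0)"
    if "\<forall>j\<in>{1..k}. (\<Sum>l<n. ?f j l * x l) = 0" "i \<le> k" for x i k
  proof (cases "i = 0")
    case False
    then have "i \<in> {1..k}" using that(2) by simp
    then show ?thesis using that(1) alternating_functional[of i x] by fastforce
  qed simp
  show ?thesis
  proof (cases "even g")
    case True
    then have g: "g = 2 * m" by (simp add: m_def)
    show ?thesis
    proof (cases "?\<epsilon> = 1")
      case eps1: True
      \<comment> \<open>\<open>alt m\<close> equals \<open>?\<epsilon>\<close>, so the relation at
        \<open>i = m\<close> follows from \<open>cv g = cv 0\<close>, and \<open>m - 1\<close>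
        constraints suffice.\<close>
      have altm: "alt m = 1" using eps1 g by (simp add: alt_def \<tau>_def)
      have "?pos \<le> card {1..m - 1}"
      proof (rule card_positive_le[where f = ?f])
        fix x :: "nat \<Rightarrow> real"
        assume *: "\<forall>j\<in>{1..m - 1}. (\<Sum>k<n. ?f j k * x k) = 0"
        have x: "x (cv (2 * i)) = alt i * x (cv 0)" if "i \<le> m" for i
        proof (cases "i = m")
          case True
          then show ?thesis using altm g cv_add_g[of 0] by simp
        next
          case False
          then show ?thesis using alt_ext[OF *, of i] that by simp
        qed
        show "(\<Sum>k<n. \<Sum>l<n. a k l * x k * x l) \<le> 0"
          using alternating_path_sum_zero[of m x, OF x] by (simp add: quadratic_form_cycle flip: g)
      qed simp
      then show ?thesis using True eps1 g g_ge_3 ud(2) by simp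
    next
      case False
      then have "?\<epsilon> = -1" using eps by blast
      then show ?thesis using True full ub ud(2) g by simp
    qed
  next
    case False
    then have g: "g = Suc (2 * m)" by (simp add: m_def)
    have Q: "(\<Sum>k<n. \<Sum>l<n. a k l * x k * x l) = 2 * ?\<epsilon> * (x (cv 0))\<^sup>2"
      if "\<forall>j\<in>{1..m}. (\<Sum>k<n. ?f j k * x k) = 0" for x
    proof -
      note x = alt_ext[OF that]
      have "cv (Suc (2 * m)) = cv 0" using g cv_add_g[of 0] by simp
      \<comment> \<open>The pairs of edges cancel, leaving the closing edge from position
        \<open>2 * m\<close> to position \<open>0\<close>.\<close>
      then have "(\<Sum>p<g. s p * x (cv p) * x (cv (Suc p))) = s (2 * m) * alt m * (x (cv 0))\<^sup>2"
        using alternating_path_sum_zero[of m x, OF x] x[of m] by (simp add: g power2_eq_square)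
      moreover have "s (2 * m) * alt m = ?\<epsilon>" by (simp add: alt_def \<tau>_def g)
      ultimately show ?thesis by (simp add: quadratic_form_cycle)
    qed
    show ?thesis
    proof (cases "?\<epsilon> = 1")
      case eps1: True
      \<comment> \<open>The form is nonnegative under \<open>m\<close> constraints, so at most
        \<open>m\<close> eigenvalues are negative; nonsingularity leaves at least
        \<open>m + 1\<close> positive ones.\<close>
      have "?neg \<le> card {1..m}"
        by (rule card_negative_le[where f = ?f]) (simp, subst Q, use eps1 in auto)
      then show ?thesis using eps1 False full ub ud(2) g by simp
    next
      case eps1: False
      then have "?\<epsilon> = -1" using eps by blast
      then have "?pos \<le> card {1..m}"
        by (intro card_positive_le[where f = ?f]) (simp, subst Q, auto)
      then show ?thesis using eps1 False ud(2) g by simp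
    qed
  qed
qed

text \<open>\<open>g mod 4\<close> fixes both the parity of \<open>g\<close> and the factor
  \<open>(-1) ^ (g div 2)\<close>.\<close>

lemma pos_inertia_cycle_iff_balanced:
  "pos_inertia (adj_matrix n E sg) = (length cs + 1) div 2 \<longleftrightarrow>
          (balanced_cycle sg cs \<and> length cs mod 4 \<in> {1, 2}) \<or>
          (\<not> balanced_cycle sg cs \<and> length cs mod 4 \<in> {0, 3})"
proof -
  define q r where "q = g div 4" and "r = g mod 4"
  have g: "g = 4 * q + r" "r < 4" by (simp_all add: q_def r_def)
  have pw: "(-1) ^ (g div 2) = (-1 :: real) ^ (r div 2)"
  proof -
    have "g div 2 = 2 * q + r div 2" using g by simp
    then show ?thesis by (simp add: power_add)
  qed
  have par: "even g \<longleftrightarrow> even r" using g by simp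
  consider "r = 0" | "r = 1" | "r = 2" | "r = 3" using g by linarith
  then show ?thesis
    unfolding pos_inertia_cycle balanced_iff pw par r_def[symmetric]
    using tau_sign by cases auto
qed

end

section \<open>Graphs with major vertices\<close>

abbreviation mj :: "nat \<Rightarrow> bool" where "mj p \<equiv> major_vertex n E cs (cv p)"

definition dist_major :: "nat \<Rightarrow> nat" where "dist_major p = (LEAST k. mj (p + k))"

definition pendant :: "nat \<Rightarrow> nat" where "pendant v = (SOME u. u < n \<and> u \<notin> set cs \<and> E v u)"

text \<open>Meant for positions at even distance: there the successor of a nonmajor vertex has odd
  distance, so every partner lies off the cover.\<close>

definition partner :: "nat \<Rightarrow> nat" where
  "partner p = (if mj p then pendant (cv p) else cv (Suc p))"

lemma pendant:
  assumes "mj p"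
  shows "pendant (cv p) < n" "pendant (cv p) \<notin> set cs" "E (cv p) (pendant (cv p))"
proof -
  have "\<exists>u. u < n \<and> u \<notin> set cs \<and> E (cv p) u" using assms by (auto simp: major_vertex_def)
  from someI_ex[OF this] show "pendant (cv p) < n" "pendant (cv p) \<notin> set cs" "E (cv p) (pendant (cv p))"
    unfolding pendant_def by blast+
qed

lemma pendant_neighbour_unique:
  assumes "mj p" "v \<in> set cs" "E (pendant (cv p)) v"
  shows "v = cv p"
proof -
  obtain u where u: "\<And>w. w \<in> set cs \<Longrightarrow> E (pendant (cv p)) w \<Longrightarrow> w = u"
    using outside_unique_neighbour[OF pendant(1,2)[OF assms(1)]] by blast
  have "E (pendant (cv p)) (cv p)" using edgeD[OF pendant(3)[OF assms(1)]] by blast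
  then show ?thesis using u[OF cv_in] u[OF assms(2,3)] by simp
qed

lemma cv_add_cong: "cv p = cv q \<Longrightarrow> cv (p + k) = cv (q + k)"
  unfolding cv_eq_iff by (rule mod_add_cong) auto

lemma dist_major_cong:
  assumes "cv p = cv q"
  shows "dist_major p = dist_major q"
proof -
  have "mj (p + k) = mj (q + k)" for k unfolding cv_add_cong[OF assms] by (rule refl)
  then show ?thesis unfolding dist_major_def by presburger
qed

section \<open>Graphs with a vertex off the cycle\<close>

context
  assumes outside: "set cs \<noteq> {..<n}"
begin

lemma exists_major: "\<exists>k<g. mj (p + k)"
proof -
  obtain v where v: "v < n" "v \<notin> set cs" using outside cs_lt by auto
  then obtain u where u: "u \<in> set cs" "E v u" by (rule outside_unique_neighbour)
  obtain q where q: "q < g" "u = cv q" using u(1) by (rule in_cs_obtain)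
  \<comment> \<open>The forward distance from \<open>p\<close> to \<open>q\<close>; adding
    \<open>g - p mod g\<close> replaces a subtraction that could drop below zero.\<close>
  define k where "k = (q + (g - p mod g)) mod g"
  have lt: "r mod g < g" for r using g_ge_3 by (intro mod_less_divisor) linarith
  have "(p + k) mod g = (p mod g + (q + (g - p mod g))) mod g"
    unfolding k_def by (simp add: mod_simps)
  also have "p mod g + (q + (g - p mod g)) = q + g" using lt[of p] by simp
  finally have "cv (p + k) = cv q" unfolding cv_eq_iff by simp
  then have "mj (p + k)" using u v q edgeD[OF u(2)] by (auto simp: major_vertex_def)
  then show ?thesis using lt unfolding k_def by blast
qed

lemma dist_major_less_g: "dist_major p < g"
proof -
  obtain k where k: "k < g" "mj (p + k)" using exists_major[of p] by blast
  have "dist_major p \<le> k" unfolding dist_major_def by (rule Least_le) (rule k(2))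
  then show ?thesis using k(1) by simp
qed

lemma dist_major_zero [simp]: "mj p \<Longrightarrow> dist_major p = 0"
  unfolding dist_major_def by (rule Least_eq_0) simp

lemma dist_major_Suc: "\<not> mj p \<Longrightarrow> dist_major p = Suc (dist_major (Suc p))"
proof -
  assume "\<not> mj p"
  moreover obtain k where "mj (p + k)" using exists_major[of p] by blast
  ultimately show ?thesis
    unfolding dist_major_def using Least_Suc[of "\<lambda>k. mj (p + k)" k] by simp
qed

text \<open>Subtracting one from a least positive distance amounts to starting at the next position.
  From a single major vertex both counts run round the cycle and give \<open>g - 1\<close>.\<close>

lemma major_gap_eq:
  "major_gap n E cs p = dist_major (Suc p)"
proof -
  obtain k where k: "mj (Suc p + k)" using exists_major[of "Suc p"] by blast
  have "(LEAST d. 0 < d \<and> mj (p + d)) = Suc (LEAST d. 0 < Suc d \<and> mj (p + Suc d))"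
    by (rule Least_Suc[of _ "Suc k"]) (use k in auto)
  then show ?thesis by (simp add: major_gap_def dist_major_def cv_def)
qed

section \<open>The cover, its matching and the kernel\<close>

definition even_pos :: "nat set" where "even_pos = {p. p < g \<and> even (dist_major p)}"

lemma cv_in_cover_iff: "cv p \<in> cv ` even_pos \<longleftrightarrow> even (dist_major p)"
proof
  assume "even (dist_major p)"
  moreover have "dist_major (p mod g) = dist_major p" by (rule dist_major_cong) simp
  moreover have "p mod g < g" using g_ge_3 by (intro mod_less_divisor) linarith
  ultimately show "cv p \<in> cv ` even_pos" by (intro image_eqI[of _ _ "p mod g"]) (auto simp: even_pos_def)
next
  assume "cv p \<in> cv ` even_pos"
  then obtain q where "cv p = cv q" "even (dist_major q)" by (auto simp: even_pos_def)
  then show "even (dist_major p)" using dist_major_cong[of p q] by simp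
qed

lemma card_cover: "card (cv ` even_pos) = card even_pos"
  by (intro card_image inj_on_subset[OF inj_cv]) (auto simp: even_pos_def)

text \<open>Along a cycle edge leaving a nonmajor vertex the distance drops by one, so one end is
  even; a major vertex has distance zero, which covers its outside edges too.\<close>

lemma cover: "E i j \<Longrightarrow> i \<in> cv ` even_pos \<or> j \<in> cv ` even_pos"
proof -
  have inside: "cv p \<in> cv ` even_pos \<or> cv (Suc p) \<in> cv ` even_pos" for p
    unfolding cv_in_cover_iff using dist_major_Suc[of p] by (cases "mj p") auto
  have out: "i \<in> cv ` even_pos" if ij: "E i j" "j \<notin> set cs" for i j
  proof -
    have "i \<in> set cs" using outside_independent[OF ij(1)] ij(2) by blast
    then obtain p where p: "i = cv p" by (rule in_cs_obtain)
    have "mj p" using ij edgeD[OF ij(1)] by (auto simp: major_vertex_def p)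
    then show ?thesis unfolding p cv_in_cover_iff by simp
  qed
  assume ij: "E i j"
  show ?thesis
  proof (cases "i \<in> set cs \<and> j \<in> set cs")
    case True
    then obtain p q where "i = cv p" "j = cv q" by (metis in_cs_obtain)
    then show ?thesis using chordless[of p q] ij inside[of p] inside[of q] by auto
  next
    case False
    then show ?thesis using out[of i j] out[of j i] ij edgeD[OF ij] by blast
  qed
qed

text \<open>A pendant vertex determines its cycle neighbour, a successor its predecessor, and the
  two kinds cannot coincide because only the latter is on the cycle.\<close>

lemma partner_inj: "inj_on partner even_pos"
proof (rule inj_onI)
  fix p q assume pq: "p \<in> even_pos" "q \<in> even_pos" "partner p = partner q"
  have "cv p = cv q"
  proof (cases "mj p \<longleftrightarrow> mj q")
    case True
    show ?thesis
    proof (cases "mj p")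
      case mp: True
      then have "pendant (cv p) = pendant (cv q)" using pq(3) True by (simp add: partner_def)
      then show ?thesis
        using pendant_neighbour_unique[of p "cv q"] mp True edgeD[OF pendant(3)[of q]] by simp
    next
      case False
      then show ?thesis using pq(3) True by (simp add: partner_def cv_Suc_eq_iff)
    qed
  next
    case False
    then show ?thesis
      using pq(3) pendant(2)[of p] pendant(2)[of q] cv_in unfolding partner_def by metis
  qed
  then show "p = q" using pq(1,2) by (simp add: even_pos_def cv_eq_iff)
qed

lemma partner_notin_cover: "p \<in> even_pos \<Longrightarrow> partner p \<notin> cv ` even_pos"
proof (cases "mj p")
  case True
  then show ?thesis using pendant(2)[OF True] by (auto simp: partner_def)
next
  case False
  assume "p \<in> even_pos"
  then have "even (dist_major p)" by (simp add: even_pos_def)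
  then show ?thesis
    using False dist_major_Suc[OF False] by (simp add: partner_def cv_in_cover_iff)
qed

text \<open>Pendant rows annihilate the major vertices. Rows of nonmajor vertices carry zeros in
  steps of two: backwards at even distance, forwards at odd distance. Rows of major vertices finally
  annihilate the pendants.\<close>

lemma kernel_trivial_on_matched:
  assumes supp: "\<And>k. k \<notin> cv ` even_pos \<union> partner ` even_pos \<Longrightarrow> x k = 0"
    and ker: "\<And>k. k < n \<Longrightarrow> (\<Sum>l<n. a k l * x l) = 0"
    and k: "k \<in> cv ` even_pos \<union> partner ` even_pos"
  shows "x k = 0"
proof -
  have minor: "s p * x (cv p) + s (Suc p) * x (cv (Suc (Suc p))) = 0" if "\<not> mj (Suc p)" for p
    using ker[of "cv (Suc p)"] row_minor_vertex[OF that, of x] by simp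
  have major: "x (cv p) = 0" if "mj p" for p
  proof -
    let ?u = "pendant (cv p)"
    \<comment> \<open>A pendant vertex has its cycle vertex as only neighbour, so its row has one
      entry.\<close>
    have "(\<Sum>l<n. a ?u l * x l) = (\<Sum>l<n. if l = cv p then a ?u (cv p) * x (cv p) else 0)"
    proof (rule sum.cong)
      fix l assume "l \<in> {..<n}"
      show "a ?u l * x l = (if l = cv p then a ?u (cv p) * x (cv p) else 0)"
        using pendant_neighbour_unique[OF that, of l] outside_independent[of ?u l] pendant(2)[OF that]
        by (auto simp: a_def)
    qed simp
    then have "a ?u (cv p) * x (cv p) = 0" using ker[OF pendant(1)[OF that]] by simp
    then show ?thesis using edgeD[OF pendant(3)[OF that]] sg_sign[of ?u "cv p"] by (auto simp: a_def)
  qed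
  have evens: "x (cv p) = 0" if "even (dist_major p)" for p
    using that
  proof (induction "dist_major p" arbitrary: p rule: less_induct)
    case less
    show ?case
    proof (cases "mj p")
      case False
      have d: "dist_major p = Suc (dist_major (Suc p))" by (rule dist_major_Suc[OF False])
      then have nm: "\<not> mj (Suc p)" using less.prems by auto
      then have d2: "dist_major (Suc p) = Suc (dist_major (Suc (Suc p)))" by (rule dist_major_Suc)
      have "x (cv (Suc (Suc p))) = 0"
        by (rule less.hyps) (use d d2 less.prems in auto)
      then show ?thesis using minor[OF nm] by simp
    qed (rule major)
  qed
  have odds: "x (cv p) = 0" if "odd (dist_major p)" for p
    using that
  \<comment> \<open>The induction goes towards larger distances, which stay below
    \<open>g\<close>.\<close>
  proof (induction "g - dist_major p" arbitrary: p rule: less_induct)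
    case less
    \<comment> \<open>Two positions before \<open>p\<close>; \<open>g\<close> is added to keep the
      subtraction exact.\<close>
    define r where "r = p + g - 2"
    have "Suc (Suc r) = p + g" using g_ge_3 by (simp add: r_def)
    then have r: "cv p = cv (Suc (Suc r))" by simp
    then have dp: "dist_major p = dist_major (Suc (Suc r))" by (rule dist_major_cong)
    show ?case
    proof (cases "mj (Suc r)")
      case True
      \<comment> \<open>Just after a major vertex, a position at odd distance is unmatched, because
        its predecessor is paired with a pendant vertex. So \<open>x\<close> vanishes there by its
        support.\<close>
      have "cv p \<notin> cv ` even_pos" using less.prems by (simp add: cv_in_cover_iff)
      moreover have "cv p \<notin> partner ` even_pos"
      proof
        assume "cv p \<in> partner ` even_pos"
        then obtain q where q: "cv (Suc (Suc r)) = partner q" using r by auto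
        show False
        proof (cases "mj q")
          case True
          then show ?thesis using q pendant(2)[OF True] cv_in[of "Suc (Suc r)"] by (simp add: partner_def)
        next
          case False
          then have "cv (Suc r) = cv q" using q by (simp add: partner_def cv_Suc_eq_iff)
          then show ?thesis using False True by simp
        qed
      qed
      ultimately show ?thesis using supp by blast
    next
      case False
      have d1: "dist_major (Suc r) = Suc (dist_major p)"
        unfolding dp by (rule dist_major_Suc[OF False])
      have "x (cv r) = 0"
      proof (cases "mj r")
        case nm: False
        have "dist_major r = Suc (Suc (dist_major p))"
          using dist_major_Suc[OF nm] d1 by simp
        then show ?thesis using dist_major_less_g[of r] less.prems by (intro less.hyps) auto
      qed (rule major)
      then show ?thesis using minor[OF False] r by simp
    qed
  qed
  have cyc: "x (cv p) = 0" for p using evens odds by blast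
  show ?thesis
  proof (cases "k \<in> set cs")
    case True
    then show ?thesis using cyc by (metis in_cs_obtain)
  next
    case False
    then obtain p where p: "k = partner p" using k by auto
    then have mp: "mj p" and kp: "k = pendant (cv p)" using False by (auto simp: partner_def split: if_splits)
    define r where "r = p + g - 1"
    have "Suc r = p + g" using g_ge_3 by (simp add: r_def)
    then have r: "cv p = cv (Suc r)" by simp
    have "(\<Sum>l\<in>{..<n} - set cs. a (cv p) l * x l) = 0"
      using ker[of "cv p"] row_cycle_vertex[of r x] cyc by (simp add: r)
    \<comment> \<open>Among the outside neighbours of \<open>cv p\<close> only the chosen pendant
      \<open>k\<close> is matched, so only \<open>k\<close> can carry a nonzero value.\<close>
    also have "(\<Sum>l\<in>{..<n} - set cs. a (cv p) l * x l) = (\<Sum>l\<in>{k}. a (cv p) l * x l)"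
    proof (rule sum.mono_neutral_right)
      show "\<forall>l\<in>{..<n} - set cs - {k}. a (cv p) l * x l = 0"
      proof (intro ballI)
        fix l assume l: "l \<in> {..<n} - set cs - {k}"
        show "a (cv p) l * x l = 0"
        proof (cases "l \<in> partner ` even_pos \<and> E (cv p) l")
          case True
          then obtain q where q: "l = partner q" by blast
          then have mq: "mj q" "l = pendant (cv q)" using l by (auto simp: partner_def split: if_splits)
          then have "cv p = cv q"
            using pendant_neighbour_unique[OF mq(1), of "cv p"] True edgeD[of "cv p" l] by simp
          then show ?thesis using l mq kp by simp
        next
          case False
          moreover have "l \<notin> cv ` even_pos" using l by auto
          ultimately show ?thesis using supp[of l] by (auto simp: a_def)
        qed
      qed
    qed (use pendant[OF mp] kp in auto)
    finally show ?thesis using sg_sign[OF pendant(3)[OF mp]] pendant(3)[OF mp] by (auto simp: a_def kp)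
  qed
qed

lemma pos_inertia_eq_card: "pos_inertia (adj_matrix n E sg) = card even_pos"
proof -
  have fin: "finite even_pos" by (simp add: even_pos_def)
  have "cv ` even_pos \<inter> partner ` even_pos = {}"
    unfolding disjoint_iff using partner_notin_cover by (metis imageE)
  then have "card (cv ` even_pos \<union> partner ` even_pos) = card (cv ` even_pos) + card (partner ` even_pos)"
    by (intro card_Un_disjoint finite_imageI fin)
  then have "card (cv ` even_pos \<union> partner ` even_pos) = 2 * card (cv ` even_pos)"
    using card_image[OF partner_inj] card_cover by simp
  moreover have "partner p < n" for p using pendant(1) by (simp add: partner_def)
  ultimately have "pos_inertia (adj_matrix n E sg) = card (cv ` even_pos)"
    using kernel_trivial_on_matched
    by (intro pos_inertia_eq_vertex_cover[of _ "cv ` even_pos \<union> partner ` even_pos"] cover) auto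
  then show ?thesis by (simp add: card_cover)
qed

text \<open>The successor of \<open>p\<close> is at even distance iff \<open>p\<close> either is at
  odd distance or is major with an even gap. Shifting is a bijection, so the even positions exceed
  the odd ones by the number of even gaps, while together they number \<open>g\<close>.\<close>

lemma twice_card_even_dist:
  "2 * card even_pos = g + card {p. p < g \<and> mj p \<and> even (dist_major (Suc p))}"
proof -
  let ?Od = "{p. p < g \<and> odd (dist_major p)}" and ?M = "{p. p < g \<and> mj p \<and> even (dist_major (Suc p))}"
  have "card (cv ` even_pos) = card ((\<lambda>p. cv (Suc p)) ` (?Od \<union> ?M))"
  proof (rule arg_cong[where f = card], intro equalityI subsetI)
    fix v assume "v \<in> cv ` even_pos"
    then obtain p where p: "v = cv p" "p < g" "even (dist_major p)" by (auto simp: even_pos_def)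
    define r where "r = (p + g - 1) mod g"
    have "cv (p + g - 1) = cv r" by (simp add: r_def)
    then have "cv (Suc (p + g - 1)) = cv (Suc r)" by (simp only: cv_Suc_eq_iff)
    moreover have "Suc (p + g - 1) = p + g" using g_ge_3 by simp
    ultimately have r: "cv (Suc r) = cv p" by simp
    then have "even (dist_major (Suc r))" using dist_major_cong[OF r] p by simp
    moreover have "r < g" unfolding r_def using g_ge_3 by (intro mod_less_divisor) linarith
    ultimately have "r \<in> ?Od \<union> ?M" using dist_major_Suc[of r] by (cases "mj r") auto
    then show "v \<in> (\<lambda>p. cv (Suc p)) ` (?Od \<union> ?M)" using r p(1) by force
  next
    fix v assume "v \<in> (\<lambda>p. cv (Suc p)) ` (?Od \<union> ?M)"
    then obtain p where p: "v = cv (Suc p)" "p \<in> ?Od \<union> ?M" by blast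
    have "even (dist_major (Suc p))"
      using p(2) dist_major_Suc[of p] by (cases "mj p") auto
    then show "v \<in> cv ` even_pos" by (simp add: p(1) cv_in_cover_iff)
  qed
  also have "\<dots> = card (?Od \<union> ?M)"
    by (rule card_image, rule inj_onI) (simp only: cv_Suc_eq_iff, auto simp: cv_eq_iff)
  also have "\<dots> = card ?Od + card ?M"
    by (rule card_Un_disjoint) auto
  finally have "card even_pos = card ?Od + card ?M" by (simp add: card_cover)
  moreover have "card {..<g} = card even_pos + card ?Od"
  proof -
    have "{..<g} = even_pos \<union> ?Od" "even_pos \<inter> ?Od = {}" by (auto simp: even_pos_def)
    moreover have "finite even_pos" "finite ?Od" by (simp_all add: even_pos_def)
    ultimately show ?thesis by (simp only: card_Un_disjoint)
  qed
  ultimately show ?thesis by simp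
qed

lemma twice_pos_inertia:
  "2 * pos_inertia (adj_matrix n E sg) =
    g + card {p. p < g \<and> major_vertex n E cs (cs ! p) \<and> even (major_gap n E cs p)}"
proof -
  have "{p. p < g \<and> major_vertex n E cs (cs ! p) \<and> even (major_gap n E cs p)} =
      {p. p < g \<and> mj p \<and> even (dist_major (Suc p))}"
    by (auto simp: major_gap_eq cv_def)
  then show ?thesis using twice_card_even_dist by (simp add: pos_inertia_eq_card)
qed

end

end

theorem theorem4p2:
  fixes n :: nat and E :: "nat \<Rightarrow> nat \<Rightarrow> bool" and sg :: "nat \<Rightarrow> nat \<Rightarrow> real"
    and cs :: "nat list"
  assumes "signed_graph n E sg"
    and "canonical_unicyclic n E"
    and "is_cycle n E cs"
  shows
   "(set cs = {..<n} \<longrightarrow>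
       (pos_inertia (adj_matrix n E sg) = (length cs + 1) div 2 \<longleftrightarrow>
          (balanced_cycle sg cs \<and> length cs mod 4 \<in> {1, 2}) \<or>
          (\<not> balanced_cycle sg cs \<and> length cs mod 4 \<in> {0, 3}))) \<and>
    (set cs \<noteq> {..<n} \<and> length cs mod 4 \<in> {1, 3} \<longrightarrow>
       (pos_inertia (adj_matrix n E sg) = (length cs + 1) div 2 \<longleftrightarrow>
          card {p. p < length cs \<and> major_vertex n E cs (cs ! p) \<and> even (major_gap n E cs p)} = 1)) \<and>
    (set cs \<noteq> {..<n} \<and> length cs mod 4 \<in> {0, 2} \<longrightarrow>
       (pos_inertia (adj_matrix n E sg) = (length cs + 1) div 2 \<longleftrightarrow>
          (\<forall>p < length cs. major_vertex n E cs (cs ! p) \<longrightarrow> odd (major_gap n E cs p))))"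
proof -
  interpret canonical_signed_graph n E sg cs
    using assms by (rule canonical_signed_graph.intro)
  let ?M = "{p. p < length cs \<and> major_vertex n E cs (cs ! p) \<and> even (major_gap n E cs p)}"
  let ?i = "pos_inertia (adj_matrix n E sg)"
  have odd: "?i = (length cs + 1) div 2 \<longleftrightarrow> card ?M = 1"
    if "set cs \<noteq> {..<n}" "length cs mod 4 \<in> {1, 3}"
  proof -
    \<comment> \<open>For odd length, \<open>2 * ?i = g + card ?M\<close> equals
      \<open>g + 1\<close> exactly when \<open>card ?M = 1\<close>; for even length, below, it
      equals \<open>g\<close> exactly when \<open>card ?M = 0\<close>.\<close>
    have "length cs mod 2 = 1" using that(2) unfolding insert_iff empty_iff by presburger
    then show ?thesis using twice_pos_inertia[OF that(1)] by presburger
  qed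
  have even: "?i = (length cs + 1) div 2 \<longleftrightarrow> (\<forall>p < length cs. major_vertex n E cs (cs ! p) \<longrightarrow> odd (major_gap n E cs p))"
    if "set cs \<noteq> {..<n}" "length cs mod 4 \<in> {0, 2}"
  proof -
    have "length cs mod 2 = 0" using that(2) unfolding insert_iff empty_iff by presburger
    then have "?i = (length cs + 1) div 2 \<longleftrightarrow> card ?M = 0"
      using twice_pos_inertia[OF that(1)] by presburger
    also have "\<dots> \<longleftrightarrow> ?M = {}" by (subst card_eq_0_iff) simp
    finally show ?thesis by blast
  qed
  show ?thesis using pos_inertia_cycle_iff_balanced odd even by (intro conjI impI) simp_all
qed

end
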